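(* Let $k>0$. For $\lambda,\rho,v\in\mathbb{C}$ with $\Re\left(\frac{v}{k}\right)>-1$, $\Re(\lambda+\rho)>0$, $\Re\left(\lambda+\frac{v}{k}\right)>0$ and $z>0$ (where $z$ is the variable of integration), the following holds, $y$ being a parameter: $$\int_{0}^{1}z^{\lambda+\rho-1}(1-z)^{2\lambda-1}\left(1-\frac{z}{3}\right)^{2(\lambda+\rho)-1}\left(1-\frac{z}{4}\right)^{\lambda-1}J_{v}^{k}\left(\frac{y\left(1-\frac{z}{4}\right)(1-z)^2}{2}\right)dz$$ $$=\frac{\left(\frac{y}{2}\right)^{v/k}\,\Gamma(\lambda+\rho)\left(\frac{2}{3}\right)^{2(\lambda+\rho)}}{k^{v/k}}\;{}_1\Psi_{2}\left[\begin{array}{c}\left(\lambda+\frac{v}{k},2\right)\\ \left(\frac{v}{k}+1,1\right),\ \left(2\lambda+\frac{v}{k}+\rho,2\right)\end{array};\ -\frac{y^2}{4k}\right].$$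
   Context: The $k$-gamma function is $\Gamma_k(s)=\int_0^\infty t^{s-1}e^{-t^k/k}\,dt$, and satisfies $\Gamma_k(s)=k^{\frac{s}{k}-1}\Gamma(s/k)$, where $\Gamma$ is the gamma function. The classical $k$-Bessel function is given, for $k>0$, by $$J_{v}^{k}(x)=\sum_{n=0}^{\infty}\frac{(-1)^n}{\Gamma_k(v+nk+k)\,n!}\left(\frac{x}{2}\right)^{\frac{v}{k}+2n}.$$ The Wright-type hypergeometric function is $${}_1\Psi_2\left[\begin{array}{c}(\alpha_1,A_1)\\(\beta_1,B_1),(\beta_2,B_2)\end{array};x\right]=\sum_{n=0}^\infty\frac{\Gamma(\alpha_1+A_1n)}{\Gamma(\beta_1+B_1n)\Gamma(\beta_2+B_2n)}\frac{x^n}{n!}.$$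
   Formalization: The printed formula is false: with J_v^k at y(1-z/4)(1-z)^2/2 the right side would need (y/4)^{v/k} and -y^2/(16k). The formal version drops this "/2", so J_v^k is taken at y(1-z/4)(1-z)^2; the right side is as printed. *)

theory Defs
  imports "HOL-Analysis.Analysis"
begin

definition k_Gamma :: "real \<Rightarrow> complex \<Rightarrow> complex" where
  "k_Gamma k s =
     (LINT t:{0<..}|lborel. complex_of_real t powr (s - 1) * complex_of_real (exp (- (t powr k) / k)))"

(* Principal power with w^0 = 1 also at w = 0.  The library has 0 powr 0 = 0,
   which would give the zeroth Bessel function the value 0 instead of 1 at the origin. *)
definition cpow :: "complex \<Rightarrow> complex \<Rightarrow> complex" where
  "cpow w a = (if a = 0 then 1 else w powr a)"

(* The integral defining k_Gamma converges at every v + n k + k exactly when Re (v / k) > -1;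
   outside that range the value below is meaningless.
   The halving of the argument takes place here, so the integrand of the theorem
   carries y (1 - z / 4) (1 - z)^2 without a further factor 1 / 2. *)
definition k_bessel :: "real \<Rightarrow> complex \<Rightarrow> complex \<Rightarrow> complex" where
  "k_bessel k v x =
     (\<Sum>n. (-1) ^ n / (k_Gamma k (v + of_nat n * of_real k + of_real k) * fact n)
            * cpow (x / 2) (v / of_real k + 2 * of_nat n))"

(* Gamma is 0 at its poles and division by 0 gives 0, so the reciprocal
   Gamma factors vanish at the poles, as they should. *)
definition wright_1Psi2 ::
  "complex \<Rightarrow> real \<Rightarrow> complex \<Rightarrow> real \<Rightarrow> complex \<Rightarrow> real \<Rightarrow> complex \<Rightarrow> complex" where
  "wright_1Psi2 \<alpha>1 A1 \<beta>1 B1 \<beta>2 B2 x =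
     (\<Sum>n. Gamma (\<alpha>1 + of_real A1 * of_nat n)
            / (Gamma (\<beta>1 + of_real B1 * of_nat n) * Gamma (\<beta>2 + of_real B2 * of_nat n))
            * (x ^ n / fact n))"

end

theory Submission
  imports Defs
begin

text \<open>
  Under \<open>u = 9/4 * z * (1 - z/3)\<^sup>2\<close>, where \<open>1 - u = (1 - z)\<^sup>2 * (1 - z/4)\<close>, the Lavoie--Trottier
  integral becomes a Beta integral. The argument of the Bessel function is \<open>y * (1 - u)\<close>, so the
  \<open>n\<close>-th term of its series only shifts the second Beta parameter to \<open>l + v/k + 2n\<close>. Since
  \<open>0 < 1 - u < 1\<close>, the kernel of every term is dominated by that of the term \<open>n = 0\<close>,
  which justifies termwise integration.
\<close>

section \<open>Complex powers of real bases, and integrability over Borel sets\<close>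

lemma complex_notin_nonpos_Ints: "Re z > 0 \<Longrightarrow> z \<notin> \<int>\<^sub>\<le>\<^sub>0"
  by (auto elim!: nonpos_Ints_cases)

lemma complex_of_real_powr_eq_exp:
  assumes "x > 0"
  shows "complex_of_real x powr a = exp (a * of_real (ln x))"
  using assms by (simp add: powr_def Ln_of_real)

text \<open>Continuity is no help across the branch cut on the negative axis. Written out with the
  real logarithm of the absolute value and the argument 0 or \<open>pi\<close>, the power is visibly
  built from Borel functions.\<close>

lemma measurable_complex_of_real_powr [measurable]:
  assumes [measurable]: "f \<in> borel_measurable M"
  shows "(\<lambda>x. complex_of_real (f x) powr a) \<in> borel_measurable M"
proof -
  have "(\<lambda>x. complex_of_real (f x) powr a) =
      (\<lambda>x. if f x = 0 then 0
           else exp (a * (of_real (ln \<bar>f x\<bar>) + (if f x < 0 then of_real pi else 0) * \<i>)))"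
    by (auto simp: powr_def Ln_of_real' fun_eq_iff)
  also have "\<dots> \<in> borel_measurable M"
    by measurable
  finally show ?thesis .
qed

text \<open>Completing the measure does not affect integrability of a Borel function. This is the
  bridge between \<open>lborel\<close> and the substitution rule, which speaks of Lebesgue measure
  and the gauge integral.\<close>

lemma absolutely_integrable_on_iff_set_integrable_lborel:
  fixes f :: "'a::euclidean_space \<Rightarrow> 'b::euclidean_space"
  assumes "set_borel_measurable borel S f"
  shows "f absolutely_integrable_on S \<longleftrightarrow> set_integrable lborel S f"
  using assms unfolding set_integrable_def set_borel_measurable_def
  by (intro integrable_completion) simp

section \<open>Gamma and Beta integrals with complex parameters\<close>

lemma complex_Gamma_integral_lborel:
  assumes "Re a > 0"
  shows "set_integrable lborel {0<..} (\<lambda>t. complex_of_real t powr (a - 1) / of_real (exp t))"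
    and "(LINT t:{0<..}|lborel. complex_of_real t powr (a - 1) / of_real (exp t)) = Gamma a"
proof -
  show *: "set_integrable lborel {0<..} (\<lambda>t. complex_of_real t powr (a - 1) / of_real (exp t))"
    by (subst absolutely_integrable_on_iff_set_integrable_lborel [symmetric])
       (use absolutely_integrable_Gamma_integral'[OF assms] in \<open>simp_all add: set_borel_measurable_def\<close>)
  show "(LINT t:{0<..}|lborel. complex_of_real t powr (a - 1) / of_real (exp t)) = Gamma a"
    using set_borel_integral_eq_integral(2)[OF *] Gamma_integral_complex'[OF assms]
    by (simp add: integral_unique)
qed

text \<open>On the open interval the norm of the integrand is the real Beta integrand with
  parameters \<open>Re a\<close> and \<open>Re b\<close>.\<close>

lemma complex_Beta_integrable:
  assumes a: "Re a > 0" and b: "Re b > 0"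
  shows "set_integrable lborel {0<..<1}
           (\<lambda>t. complex_of_real t powr (a - 1) * complex_of_real (1 - t) powr (b - 1))"
  unfolding set_integrable_def
proof (rule Bochner_Integration.integrable_bound)
  show "integrable lborel (\<lambda>t. indicator {0..1} t *\<^sub>R (t powr (Re a - 1) * (1 - t) powr (Re b - 1)))"
    using integrable_Beta[OF a b] by (simp add: set_integrable_def)
  show "(\<lambda>t. indicator {0<..<1} t *\<^sub>R
      (complex_of_real t powr (a - 1) * complex_of_real (1 - t) powr (b - 1))) \<in> borel_measurable lborel"
    by measurable
qed (auto simp: indicator_def norm_mult norm_powr_real_powr intro!: AE_I2)

text \<open>The convolution of the Gamma integrands for \<open>a\<close> and \<open>b\<close> is the
  one for \<open>a + b\<close> times the Beta integral \<open>B\<close>. Integrating it over the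
  line, by Fubini, gives \<open>Gamma a * Gamma b = Gamma (a + b) * B\<close>.\<close>

lemma complex_Beta_integral:
  assumes a: "Re a > 0" and b: "Re b > 0"
  shows "(LINT t:{0<..<1}|lborel. complex_of_real t powr (a - 1) * complex_of_real (1 - t) powr (b - 1))
           = Beta a b"
proof -
  interpret lborel_pair: pair_sigma_finite "lborel :: real measure" "lborel :: real measure" ..
  \<comment> \<open>Extension by zero lets the convolution run over the whole line, where
    translation invariance applies.\<close>
  define g :: "complex \<Rightarrow> real \<Rightarrow> complex"
    where "g = (\<lambda>a t. indicator {0<..} t *\<^sub>R (of_real t powr (a - 1) / of_real (exp t)))"
  define B where "B = (LINT t:{0<..<1}|lborel. complex_of_real t powr (a - 1) * complex_of_real (1 - t) powr (b - 1))"
  have g_meas [measurable]: "g c \<in> borel_measurable borel" for c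
    unfolding g_def by measurable
  have g_int: "integrable lborel (g c)" "integral\<^sup>L lborel (g c) = Gamma c" if "Re c > 0" for c
    using complex_Gamma_integral_lborel[OF that]
    by (simp_all add: g_def set_integrable_def set_lebesgue_integral_def)
  have shift: "integrable lborel (\<lambda>u. f (u - t))" "(\<integral>u. f (u - t) \<partial>lborel) = integral\<^sup>L lborel f"
    if "integrable lborel f" for t :: real and f :: "real \<Rightarrow> 'b :: {banach, second_countable_topology}"
    using lborel_integrable_real_affine[OF that, of 1 "-t"] lborel_integral_real_affine[of 1 f "-t"]
    by simp_all
  have "integrable (lborel \<Otimes>\<^sub>M lborel) (\<lambda>(t, u). g a t * g b (u - t))"
  proof (rule lborel_pair.Fubini_integrable)
    show "(\<lambda>(t, u). g a t * g b (u - t)) \<in> borel_measurable (lborel \<Otimes>\<^sub>M lborel)"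
      by measurable
    show "integrable lborel (\<lambda>t. \<integral>u. norm (case (t, u) of (t, u) \<Rightarrow> g a t * g b (u - t)) \<partial>lborel)"
      using g_int(1)[OF a] shift(2)[of "\<lambda>t. norm (g b t)"] g_int(1)[OF b]
      by (simp add: norm_mult)
    show "AE t in lborel. integrable lborel (\<lambda>u. case (t, u) of (t, u) \<Rightarrow> g a t * g b (u - t))"
      using shift(1)[OF g_int(1)[OF b]] by auto
  qed
  from lborel_pair.Fubini_integral[OF this]
  have "(\<integral>u. \<integral>t. g a t * g b (u - t) \<partial>lborel \<partial>lborel) = Gamma a * Gamma b"
    using shift(2)[OF g_int(1)[OF b]] g_int(2)[OF a] g_int(2)[OF b] by simp
  moreover have "(\<integral>t. g a t * g b (u - t) \<partial>lborel) = g (a + b) u * B" for u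
  proof (cases "u > 0")
    case False
    then have "g a t * g b (u - t) = 0" for t
      by (auto simp: g_def indicator_def)
    moreover have "g (a + b) u = 0"
      using False by (simp add: g_def)
    ultimately show ?thesis
      by (simp only: mult_zero_left Bochner_Integration.integral_zero)
  next
    case True
    \<comment> \<open>The scaling \<open>t = u * s\<close> moves the support to the unit interval.
      Its Jacobian \<open>u\<close> raises the exponent \<open>a + b - 2\<close>, coming from the
      two powers, to \<open>a + b - 1\<close>.\<close>
    have "(\<integral>t. g a t * g b (u - t) \<partial>lborel) = u *\<^sub>R (\<integral>s. g a (u * s) * g b (u - u * s) \<partial>lborel)"
      using True by (subst lborel_integral_real_affine[of u _ 0]) auto
    also have "(\<integral>s. g a (u * s) * g b (u - u * s) \<partial>lborel) =
        (\<integral>s. (of_real u powr (a + b - 2) / of_real (exp u)) *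
           (indicator {0<..<1} s *\<^sub>R (complex_of_real s powr (a - 1) * complex_of_real (1 - s) powr (b - 1))) \<partial>lborel)"
    proof (rule Bochner_Integration.integral_cong [OF refl])
      fix s :: real
      show "g a (u * s) * g b (u - u * s) = (of_real u powr (a + b - 2) / of_real (exp u)) *
           (indicator {0<..<1} s *\<^sub>R (complex_of_real s powr (a - 1) * complex_of_real (1 - s) powr (b - 1)))"
      proof (cases "0 < s \<and> s < 1")
        case s: True
        have *: "u - u * s = u * (1 - s)" by (simp add: algebra_simps)
        have "exp (of_real u) = exp (of_real (u * s)) * (exp (of_real (u * (1 - s))) :: complex)"
          by (subst exp_add [symmetric]) (simp add: algebra_simps)
        moreover have "of_real u powr (a + b - 2) = of_real u powr (a - 1) * (of_real u powr (b - 1) :: complex)"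
          using True by (simp add: powr_def exp_add[symmetric] algebra_simps)
        ultimately show ?thesis
          using s True unfolding *
          by (simp add: g_def powr_times_real_left exp_of_real [symmetric] del: of_real_diff)
      next
        case False
        with True have "\<not> (u * s > 0 \<and> u - u * s > 0)"
          by (auto simp: zero_less_mult_iff)
        with False show ?thesis by (auto simp: g_def indicator_def)
      qed
    qed
    also have "u *\<^sub>R \<dots> = (u *\<^sub>R (of_real u powr (a + b - 2) / of_real (exp u))) * B"
      by (simp only: B_def set_lebesgue_integral_def integral_mult_right_zero mult_scaleR_left)
    also have "u *\<^sub>R (of_real u powr (a + b - 2) / of_real (exp u)) = g (a + b) u"
    proof -
      have "of_real u powr (a + b - 1) = of_real u * (of_real u powr (a + b - 2) :: complex)"
        using True powr_add[of "of_real u :: complex" 1 "a + b - 2"] by (simp add: algebra_simps)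
      then show ?thesis using True by (simp add: g_def scaleR_conv_of_real)
    qed
    finally show ?thesis .
  qed
  ultimately have "Gamma (a + b) * B = Gamma a * Gamma b"
    using g_int(2)[of "a + b"] a b by simp
  moreover have "Gamma (a + b) \<noteq> 0"
    using a b by (simp add: Gamma_eq_zero_iff complex_notin_nonpos_Ints)
  ultimately have "B = Beta a b"
    by (simp add: Beta_def field_simps)
  then show ?thesis
    by (simp only: B_def)
qed


section \<open>The Lavoie-Trottier integral\<close>

text \<open>In the substitution \<open>u = g z\<close> the derivative \<open>g'\<close> contributes
  one factor \<open>1 - z\<close> and one factor \<open>1 - z / 3\<close>, which turn the exponents
  \<open>2 * (b - 1)\<close> and \<open>2 * (a - 1)\<close> into \<open>2 * b - 1\<close> and
  \<open>2 * a - 1\<close>.\<close>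

lemma Lavoie_Trottier_integral:
  assumes a: "Re a > 0" and b: "Re b > 0"
  defines "K \<equiv> (\<lambda>z::real. complex_of_real z powr (a - 1) * complex_of_real (1 - z) powr (2 * b - 1)
      * complex_of_real (1 - z / 3) powr (2 * a - 1) * complex_of_real (1 - z / 4) powr (b - 1))"
  shows "set_integrable lborel {0<..<1} K"
    and "(LINT z:{0<..<1}|lborel. K z) = (2 / 3) powr (2 * a) * Beta a b"
proof -
  define g g' where "g = (\<lambda>z::real. 9 / 4 * z * (1 - z / 3)\<^sup>2)"
    and "g' = (\<lambda>z::real. 9 / 4 * (1 - z) * (1 - z / 3))"
  \<comment> \<open>The constant is the inverse of \<open>(9 / 4) powr a\<close>, which arises from
    \<open>g z\<close> to the power \<open>a - 1\<close> together with \<open>g' z\<close>.\<close>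
  define F where "F = (\<lambda>t. (2 / 3) powr (2 * a)
      * (complex_of_real t powr (a - 1) * complex_of_real (1 - t) powr (b - 1)))"
  have deriv: "(g has_field_derivative g' z) (at z within A)" for z A
    unfolding g_def g'_def
    by (auto intro!: derivative_eq_intros simp: field_simps power2_eq_square)
  \<comment> \<open>Strictness reaches the endpoint 1, although \<open>g' 1 = 0\<close>, since the
    derivative need only be positive in the interior. With \<open>g 0 = 0\<close> and
    \<open>g 1 = 1\<close> this determines the image.\<close>
  have mono: "g x < g y" if "0 \<le> x" "x < y" "y \<le> 1" for x y
  proof (rule DERIV_pos_imp_increasing_open [OF that(2)])
    show "\<exists>d. (g has_real_derivative d) (at z) \<and> 0 < d" if "x < z" "z < y" for z
      using that \<open>0 \<le> x\<close> \<open>y \<le> 1\<close> by (intro exI[of _ "g' z"] conjI deriv) (simp add: g'_def)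
    show "continuous_on {x..y} g"
      unfolding g_def by (intro continuous_intros) auto
  qed
  have inj: "inj_on g {0<..<1}"
    by (rule linorder_inj_onI') (use mono in \<open>fastforce simp: less_le\<close>)
  have image: "g ` {0<..<1} = {0<..<1}"
  proof (intro equalityI subsetI)
    fix y assume "y \<in> g ` {0<..<1}"
    then show "y \<in> {0<..<1}"
      using mono[of 0] mono[of _ 1] by (auto simp: g_def field_simps power2_eq_square)
  next
    fix y :: real assume y: "y \<in> {0<..<1}"
    have "\<exists>x\<ge>0. x \<le> 1 \<and> g x = y"
      by (rule IVT') (use y in \<open>auto simp: g_def power2_eq_square intro!: continuous_intros\<close>)
    then obtain x where x: "0 \<le> x" "x \<le> 1" "g x = y" by auto
    moreover have "x \<noteq> 0" "x \<noteq> 1"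
      using x y by (auto simp: g_def power2_eq_square)
    ultimately show "y \<in> g ` {0<..<1}" by force
  qed
  \<comment> \<open>All bases are positive, so every power is \<open>exp\<close> of its exponent
    times a real logarithm. The identity becomes a linear one between logarithms, free of branch
    questions.\<close>
  have eq: "\<bar>g' z\<bar> *\<^sub>R F (g z) = K z" if "z \<in> {0<..<1}" for z
  proof -
    have z: "0 < z" "z < 1" using that by auto
    have g_pos: "g z > 0" using z by (simp add: g_def)
    have g_less: "1 - g z = (1 - z)\<^sup>2 * (1 - z / 4)"
      by (simp add: g_def field_simps power2_eq_square power3_eq_cube)
    have ln94: "ln (9 / 4) = - 2 * ln (2 / 3 :: real)"
      using ln_realpow[of "2 / 3 :: real" 2] ln_inverse[of "9 / 4 :: real"] by (simp add: power2_eq_square)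
    have ln_g: "ln (g z) = - 2 * ln (2 / 3) + ln z + 2 * ln (1 - z / 3)"
      using z ln94
      by (simp add: g_def ln_mult ln_realpow del: times_divide_eq_left times_divide_eq_right)
    have ln_1g: "ln (1 - g z) = 2 * ln (1 - z) + ln (1 - z / 4)"
      using z unfolding g_less by (simp add: ln_mult ln_realpow)
    have g'_pos: "g' z > 0" using z by (simp add: g'_def)
    have ln_g': "ln (g' z) = - 2 * ln (2 / 3) + ln (1 - z) + ln (1 - z / 3)"
    proof -
      have "ln (g' z) = ln (9 / 4 * (1 - z)) + ln (1 - z / 3)"
        unfolding g'_def using z by (intro ln_mult_pos) auto
      moreover have "ln (9 / 4 * (1 - z)) = ln (9 / 4) + ln (1 - z)"
        using z by (intro ln_mult_pos) auto
      ultimately show ?thesis using ln94 by linarith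
    qed
    have g'_exp: "complex_of_real (g' z) = exp (of_real (ln (g' z)))"
      using g'_pos by (simp add: exp_of_real)
    have "1 - g z > 0" using z by (simp add: g_less)
    have "(2 / 3 :: complex) = complex_of_real (2 / 3)" by simp
    then have c: "(2 / 3 :: complex) powr (2 * a) = exp (2 * a * of_real (ln (2 / 3)))"
      by (metis complex_of_real_powr_eq_exp divide_pos_pos zero_less_numeral)
    have "\<bar>g' z\<bar> *\<^sub>R F (g z) = exp (of_real (ln (g' z))) * (exp (2 * a * of_real (ln (2 / 3)))
        * (exp ((a - 1) * of_real (ln (g z))) * exp ((b - 1) * of_real (ln (1 - g z)))))"
      using g'_pos g_pos \<open>1 - g z > 0\<close>
      by (simp only: F_def c complex_of_real_powr_eq_exp scaleR_conv_of_real abs_of_pos g'_exp)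
    also have "\<dots> = exp (of_real (ln (g' z)) + (2 * a * of_real (ln (2 / 3))
        + ((a - 1) * of_real (ln (g z)) + (b - 1) * of_real (ln (1 - g z)))))"
      by (simp only: exp_add)
    also have "of_real (ln (g' z)) + (2 * a * of_real (ln (2 / 3))
        + ((a - 1) * of_real (ln (g z)) + (b - 1) * of_real (ln (1 - g z)))) =
        (a - 1) * of_real (ln z) + (2 * b - 1) * of_real (ln (1 - z))
        + (2 * a - 1) * of_real (ln (1 - z / 3)) + (b - 1) * of_real (ln (1 - z / 4))"
      unfolding ln_g ln_1g ln_g' of_real_add of_real_mult by (simp add: algebra_simps)
    also have "exp \<dots> = K z"
    proof -
      have "1 - z > 0" "1 - z / 3 > 0" "1 - z / 4 > 0" using z by auto
      then show ?thesis using z(1)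
        by (simp only: K_def complex_of_real_powr_eq_exp exp_add)
    qed
    finally show ?thesis .
  qed
  have F_int: "set_integrable lborel {0<..<1} F"
    unfolding F_def by (intro set_integrable_mult_right complex_Beta_integrable a b)
  have F_integral: "(LINT t:{0<..<1}|lborel. F t) = (2 / 3) powr (2 * a) * Beta a b"
    unfolding F_def by (simp add: complex_Beta_integral[OF a b] del: of_real_diff)
  have "set_borel_measurable borel {0<..<1} F"
    unfolding set_borel_measurable_def F_def by measurable
  then have "F absolutely_integrable_on g ` {0<..<1} \<and> integral (g ` {0<..<1}) F = (2 / 3) powr (2 * a) * Beta a b"
    using absolutely_integrable_on_iff_set_integrable_lborel F_int F_integral
      set_borel_integral_eq_integral(2)[OF F_int] unfolding image by auto
  then have "(\<lambda>z. \<bar>g' z\<bar> *\<^sub>R F (g z)) absolutely_integrable_on {0<..<1} \<and>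
      integral {0<..<1} (\<lambda>z. \<bar>g' z\<bar> *\<^sub>R F (g z)) = (2 / 3) powr (2 * a) * Beta a b"
    using has_absolute_integral_change_of_variables_real[OF _ deriv inj, of F] by simp
  moreover have "(\<lambda>z. \<bar>g' z\<bar> *\<^sub>R F (g z)) absolutely_integrable_on {0<..<1} \<longleftrightarrow> K absolutely_integrable_on {0<..<1}"
    by (intro set_integrable_cong refl eq)
  moreover have "integral {0<..<1} (\<lambda>z. \<bar>g' z\<bar> *\<^sub>R F (g z)) = integral {0<..<1} K"
    by (intro integral_cong eq)
  ultimately have K: "K absolutely_integrable_on {0<..<1}" "integral {0<..<1} K = (2 / 3) powr (2 * a) * Beta a b"
    by simp_all
  show K_int: "set_integrable lborel {0<..<1} K"
  proof -
    have "set_borel_measurable borel {0<..<1} K"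
      unfolding set_borel_measurable_def K_def by measurable
    with K(1) show ?thesis
      by (simp add: absolutely_integrable_on_iff_set_integrable_lborel)
  qed
  show "(LINT z:{0<..<1}|lborel. K z) = (2 / 3) powr (2 * a) * Beta a b"
    using set_borel_integral_eq_integral(2)[OF K_int] K(2) by simp
qed

section \<open>The k-Gamma function in terms of Gamma\<close>

text \<open>Substitution of \<open>t powr k / k\<close> in the Euler integral of
  \<open>Gamma (s / k)\<close>. The constant \<open>c\<close> cancels the power of \<open>k\<close>
  that the denominator produces.\<close>

lemma k_Gamma_eq:
  assumes k: "k > 0" and s: "Re s > 0"
  shows "k_Gamma k s = of_real k powr (s / of_real k - 1) * Gamma (s / of_real k)"
proof -
  define c where "c = complex_of_real k powr (s / of_real k - 1)"
  define F where "F = (\<lambda>t. c * (complex_of_real t powr (s / of_real k - 1) / of_real (exp t)))"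
  define f where "f = (\<lambda>t. complex_of_real t powr (s - 1) * complex_of_real (exp (- (t powr k) / k)))"
  define g where "g = (\<lambda>t. t powr k / k)"
  have sk: "Re (s / of_real k) > 0" using k s by simp
  have deriv: "(g has_field_derivative t powr (k - 1)) (at t within {0<..})" if "t \<in> {0<..}" for t
    using that k unfolding g_def by (auto intro!: derivative_eq_intros)
  have inj: "inj_on g {0<..}"
  proof (rule linorder_inj_onI')
    fix x y :: real assume "x \<in> {0<..}" "y \<in> {0<..}" "x < y"
    with k powr_less_mono2[of k x y] show "g x \<noteq> g y"
      by (simp add: g_def)
  qed
  have image: "g ` {0<..} = {0<..}"
  proof (intro equalityI subsetI)
    fix x :: real assume "x \<in> {0<..}"
    with k have "x = g ((k * x) powr (1 / k))" "(k * x) powr (1 / k) \<in> {0<..}"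
      by (auto simp: g_def powr_powr)
    then show "x \<in> g ` {0<..}" by blast
  qed (use k in \<open>auto simp: g_def\<close>)
  have eq: "\<bar>t powr (k - 1)\<bar> *\<^sub>R F (g t) = f t" if "t \<in> {0<..}" for t
  proof -
    have t: "t > 0" using that by simp
    have g_pos: "g t > 0" using t k by (simp add: g_def)
    have "complex_of_real (t powr (k - 1)) = exp ((of_real k - 1) * of_real (ln t))"
      using t by (subst powr_of_real [symmetric]) (simp_all add: complex_of_real_powr_eq_exp)
    moreover have "ln (g t) = k * ln t - ln k"
      using t k by (simp add: g_def ln_div ln_powr)
    ultimately have "\<bar>t powr (k - 1)\<bar> *\<^sub>R F (g t) =
        exp ((of_real k - 1) * of_real (ln t)) * (exp ((s / of_real k - 1) * of_real (ln k))
        * exp ((s / of_real k - 1) * (of_real k * of_real (ln t) - of_real (ln k)))) * of_real (exp (- g t))"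
      using t k g_pos
      by (simp add: F_def c_def complex_of_real_powr_eq_exp scaleR_conv_of_real exp_minus divide_inverse)
    also have "exp ((of_real k - 1) * of_real (ln t)) * (exp ((s / of_real k - 1) * of_real (ln k))
        * exp ((s / of_real k - 1) * (of_real k * of_real (ln t) - of_real (ln k))))
        = exp ((s - 1) * complex_of_real (ln t))"
      unfolding exp_add [symmetric] using k by (intro arg_cong[of _ _ exp]) (simp add: field_simps)
    finally show ?thesis
      using t by (simp add: f_def g_def complex_of_real_powr_eq_exp)
  qed
  have F_int: "set_integrable lborel {0<..} F"
    unfolding F_def by (intro set_integrable_mult_right complex_Gamma_integral_lborel sk)
  have F_integral: "(LINT t:{0<..}|lborel. F t) = c * Gamma (s / of_real k)"
    unfolding F_def set_integral_mult_right by (simp only: complex_Gamma_integral_lborel[OF sk])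
  have "set_borel_measurable borel {0<..} F"
    unfolding set_borel_measurable_def F_def by measurable
  then have "F absolutely_integrable_on g ` {0<..} \<and> integral (g ` {0<..}) F = c * Gamma (s / of_real k)"
    using absolutely_integrable_on_iff_set_integrable_lborel F_int F_integral
      set_borel_integral_eq_integral(2)[OF F_int] unfolding image by auto
  then have "(\<lambda>t. \<bar>t powr (k - 1)\<bar> *\<^sub>R F (g t)) absolutely_integrable_on {0<..} \<and>
      integral {0<..} (\<lambda>t. \<bar>t powr (k - 1)\<bar> *\<^sub>R F (g t)) = c * Gamma (s / of_real k)"
    using has_absolute_integral_change_of_variables_real[OF _ deriv inj, of F] by simp
  moreover have "(\<lambda>t. \<bar>t powr (k - 1)\<bar> *\<^sub>R F (g t)) absolutely_integrable_on {0<..} \<longleftrightarrow> f absolutely_integrable_on {0<..}"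
    by (intro set_integrable_cong refl eq)
  moreover have "integral {0<..} (\<lambda>t. \<bar>t powr (k - 1)\<bar> *\<^sub>R F (g t)) = integral {0<..} f"
    by (intro integral_cong eq)
  ultimately have f: "f absolutely_integrable_on {0<..}" "integral {0<..} f = c * Gamma (s / of_real k)"
    by simp_all
  have f_int: "set_integrable lborel {0<..} f"
  proof -
    have "set_borel_measurable borel {0<..} f"
      unfolding set_borel_measurable_def f_def by measurable
    with f(1) show ?thesis
      by (simp add: absolutely_integrable_on_iff_set_integrable_lborel)
  qed
  show ?thesis
    using set_borel_integral_eq_integral(2)[OF f_int] f(2) by (simp add: k_Gamma_def f_def c_def)
qed


section \<open>Terms and coefficients of the Bessel series\<close>

lemma cpow_of_real_mult:
  assumes "r > 0"
  shows "cpow (x * of_real r) a = cpow x a * complex_of_real r powr a"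
  using assms powr_times_real_left[of "of_real r" x a] by (simp add: cpow_def mult.commute)

text \<open>The hypothesis keeps \<open>a + 2 * of_nat n\<close> away from 0 for positive
  \<open>n\<close>. There the convention \<open>cpow x 0 = 1\<close> would break the identity at
  \<open>x = 0\<close>.\<close>

lemma cpow_add_of_nat:
  assumes "Re a > -1"
  shows "cpow x (a + 2 * of_nat n) = cpow x a * x ^ (2 * n)"
proof (cases "n = 0")
  case False
  then have "Re (a + 2 * of_nat n) > 0"
    using assms by simp
  then have "a + 2 * of_nat n \<noteq> 0"
    by (metis less_irrefl zero_complex.simps(1))
  moreover have "x powr (2 * of_nat n) = x ^ (2 * n)"
    using powr_nat'[of x "2 * n"] False by simp
  ultimately show ?thesis
    using False by (cases "x = 0") (simp_all add: cpow_def powr_add)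
qed simp

text \<open>Ratio test: by the functional equation of Gamma, consecutive terms have ratio
  \<open>norm x / (norm (w + of_nat n + 1) * (n + 1))\<close>, and \<open>Re w > -1\<close> bounds
  the first factor of the denominator below by \<open>n\<close>.\<close>

lemma summable_norm_Wright_coeffs:
  assumes w: "Re w > -1"
  shows "summable (\<lambda>n. norm (x ^ n / (Gamma (w + of_nat n + 1) * fact n) :: complex))"
proof (rule summable_ratio_test [where c = "1 / 2" and N = "Suc (nat \<lceil>2 * norm x\<rceil>)"])
  fix n assume "n \<ge> Suc (nat \<lceil>2 * norm x\<rceil>)"
  then have n: "2 * norm x \<le> real n" "n \<ge> 1" by linarith+
  have "real n \<le> Re (w + of_nat n + 1)" using w by simp
  also have "\<dots> \<le> norm (w + of_nat n + 1)" by (rule complex_Re_le_cmod)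
  finally have norm_ge: "real n \<le> norm (w + of_nat n + 1)" .
  have "Gamma (w + of_nat n + 1 + 1) = (w + of_nat n + 1) * Gamma (w + of_nat n + 1)"
    using w by (intro Gamma_plus1 complex_notin_nonpos_Ints) simp
  then have Gamma: "Gamma (w + of_nat (Suc n) + 1) = (w + of_nat n + 1) * Gamma (w + of_nat n + 1)"
    by (simp add: algebra_simps)
  define C where "C = norm (x ^ n / (Gamma (w + of_nat n + 1) * fact n))"
  have "norm (x ^ Suc n / (Gamma (w + of_nat (Suc n) + 1) * fact (Suc n))) =
      norm x / (norm (w + of_nat n + 1) * real (Suc n)) * C"
    unfolding C_def Gamma by (simp add: norm_mult norm_divide norm_power del: of_nat_Suc)
  also have "norm x / (norm (w + of_nat n + 1) * real (Suc n)) \<le> (real n / 2) / (real n * 1)"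
    using n norm_ge by (intro frac_le mult_mono) auto
  also have "\<dots> = 1 / 2" using n by simp
  finally show "norm (norm (x ^ Suc n / (Gamma (w + of_nat (Suc n) + 1) * fact (Suc n)))) \<le>
      1 / 2 * norm (norm (x ^ n / (Gamma (w + of_nat n + 1) * fact n)))"
    by (simp add: C_def mult_right_mono)
qed simp

text \<open>Separates the positive factor \<open>r\<close>, which will depend on the integration
  variable, from the constants. The k-Gamma value supplies
  \<open>of_real k powr (w + of_nat n)\<close>, whose \<open>n\<close>-dependent part goes into the
  argument of the Wright series.\<close>

lemma k_bessel_term:
  assumes k: "k > 0" and w: "Re (v / of_real k) > -1" and r: "r > 0"
  shows "(-1) ^ n / (k_Gamma k (v + of_nat n * of_real k + of_real k) * fact n)
           * cpow (y * of_real r / 2) (v / of_real k + 2 * of_nat n) =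
         cpow (y / 2) (v / of_real k) / of_real k powr (v / of_real k)
           * ((- y\<^sup>2 / (4 * of_real k)) ^ n / (Gamma (v / of_real k + of_nat n + 1) * fact n)
           * of_real r powr (v / of_real k + 2 * of_nat n))"
proof -
  define w where "w = v / of_real k"
  have wk: "(v + of_nat n * of_real k + of_real k) / of_real k = w + of_nat n + 1"
    using k by (simp add: w_def add_divide_distrib)
  have "Re (v + of_nat n * of_real k + of_real k) = k * (Re w + real n + 1)"
    using k by (simp add: w_def algebra_simps)
  then have "k_Gamma k (v + of_nat n * of_real k + of_real k) =
      of_real k powr (w + of_nat n) * Gamma (w + of_nat n + 1)"
    using w k by (subst k_Gamma_eq) (simp_all add: wk, simp add: w_def)
  also have "of_real k powr (w + of_nat n) = of_real k powr w * of_real k ^ n"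
    using k by (simp add: powr_add)
  finally have "k_Gamma k (v + of_nat n * of_real k + of_real k) =
      of_real k powr w * of_real k ^ n * Gamma (w + of_nat n + 1)" .
  moreover have "cpow (y * of_real r / 2) (w + 2 * of_nat n) =
      cpow (y / 2) w * (y / 2) ^ (2 * n) * of_real r powr (w + 2 * of_nat n)"
    using cpow_of_real_mult[OF r, of "y / 2"] cpow_add_of_nat[of w "y / 2" n] w
    by (simp add: w_def)
  moreover have "(- y\<^sup>2 / (4 * of_real k)) ^ n = (-1) ^ n * (y / 2) ^ (2 * n) / of_real k ^ n"
  proof -
    have "- y\<^sup>2 / (4 * of_real k) = (-1) * (y / 2)\<^sup>2 / of_real k"
      by (simp add: power2_eq_square)
    then show ?thesis
      by (simp only: power_mult_distrib power_divide power_mult)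
  qed
  ultimately show ?thesis
    by (simp add: w_def [symmetric] mult_ac)
qed

section \<open>Termwise integration of the Bessel series\<close>

theorem corollary3p1:
  fixes k :: real and l \<rho> v y :: complex
  assumes "k > 0"
    and "Re (v / of_real k) > -1"
    and "Re (l + \<rho>) > 0"
    and "Re (l + v / of_real k) > 0"
  shows "let f = (\<lambda>z::real.
        complex_of_real z powr (l + \<rho> - 1)
      * complex_of_real (1 - z) powr (2 * l - 1)
      * complex_of_real (1 - z / 3) powr (2 * (l + \<rho>) - 1)
      * complex_of_real (1 - z / 4) powr (l - 1)
      * k_bessel k v (y * complex_of_real ((1 - z / 4) * (1 - z)\<^sup>2)))
    in set_integrable lborel {0..1} f
      \<and> (LINT z:{0..1}|lborel. f z) =
          cpow (y / 2) (v / of_real k) * Gamma (l + \<rho>) * (2 / 3) powr (2 * (l + \<rho>))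
          / (complex_of_real k powr (v / of_real k))
          * wright_1Psi2 (l + v / of_real k) 2 (v / of_real k + 1) 1
              (2 * l + v / of_real k + \<rho>) 2 (- (y\<^sup>2) / (4 * of_real k))"
proof -
  define w where "w = v / of_real k"
  define a where "a = l + \<rho>"
  define b where "b = (\<lambda>n. l + w + 2 * of_nat n)"
  define A where "A = cpow (y / 2) w / of_real k powr w"
  define x where "x = - y\<^sup>2 / (4 * of_real k)"
  define d where "d = (\<lambda>n. x ^ n / (Gamma (w + of_nat n + 1) * fact n))"
  define r where "r = (\<lambda>z::real. (1 - z / 4) * (1 - z)\<^sup>2)"
  define f where "f = (\<lambda>z::real.
        complex_of_real z powr (l + \<rho> - 1)
      * complex_of_real (1 - z) powr (2 * l - 1)
      * complex_of_real (1 - z / 3) powr (2 * (l + \<rho>) - 1)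
      * complex_of_real (1 - z / 4) powr (l - 1)
      * k_bessel k v (y * complex_of_real (r z)))"
  define K where "K = (\<lambda>n (z::real). complex_of_real z powr (a - 1) * complex_of_real (1 - z) powr (2 * b n - 1)
      * complex_of_real (1 - z / 3) powr (2 * a - 1) * complex_of_real (1 - z / 4) powr (b n - 1))"
  define T where "T = (\<lambda>n z. indicator {0<..<1} z *\<^sub>R (A * (d n * K n z)))"
  have w: "Re w > -1" and a: "Re a > 0" and b: "Re (b n) > 0" for n
    using assms by (auto simp: w_def a_def b_def)
  have K_int: "set_integrable lborel {0<..<1} (K n)"
    and K_integral: "(LINT z:{0<..<1}|lborel. K n z) = (2 / 3) powr (2 * a) * Beta a (b n)" for n
    unfolding K_def by (rule Lavoie_Trottier_integral[OF a b])+
  \<comment> \<open>As \<open>r z\<close> is the product of \<open>1 - z / 4\<close> and the square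
    of \<open>1 - z\<close>, its power merges with the kernel and replaces \<open>l\<close> by
    \<open>l + w + 2 * of_nat n\<close> in both exponents.\<close>
  have K_shift: "K n z = complex_of_real z powr (l + \<rho> - 1) * complex_of_real (1 - z) powr (2 * l - 1)
      * complex_of_real (1 - z / 3) powr (2 * (l + \<rho>) - 1) * complex_of_real (1 - z / 4) powr (l - 1)
      * of_real (r z) powr (w + 2 * of_nat n)" if "0 < z" "z < 1" for n z
  proof -
    have pos: "1 - z > 0" "1 - z / 4 > 0" using that by auto
    then have "r z > 0" "ln (r z) = ln (1 - z / 4) + 2 * ln (1 - z)"
      by (simp_all add: r_def ln_mult ln_realpow)
    then have r_powr: "complex_of_real (r z) powr (w + 2 * of_nat n) =
        complex_of_real (1 - z / 4) powr (w + 2 * of_nat n) * complex_of_real (1 - z) powr (2 * (w + 2 * of_nat n))"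
      using pos
      by (simp add: complex_of_real_powr_eq_exp algebra_simps del: of_real_diff flip: exp_add)
    have "2 * b n - 1 = (2 * l - 1) + 2 * (w + 2 * of_nat n)"
      and "b n - 1 = (l - 1) + (w + 2 * of_nat n)"
      by (simp_all add: b_def algebra_simps)
    then show ?thesis
      unfolding K_def r_powr by (simp only: powr_add a_def mult_ac)
  qed
  have T_int: "integrable lborel (T n)" for n
    unfolding T_def using K_int[of n]
    by (simp add: set_integrable_def [symmetric])
  have T_integral: "integral\<^sup>L lborel (T n) = A * (d n * ((2 / 3) powr (2 * a) * Beta a (b n)))" for n
    unfolding T_def using K_integral[of n]
    by (simp add: set_lebesgue_integral_def [symmetric])
  have d_summable: "summable (\<lambda>n. norm (d n))"
    unfolding d_def by (rule summable_norm_Wright_coeffs[OF w])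
  have T_bound: "norm (T n z) \<le> norm (d n) * norm (A * (indicator {0<..<1} z *\<^sub>R K 0 z))" for n z
  proof (cases "0 < z \<and> z < 1")
    case True
    then have r: "0 < r z" "r z \<le> 1"
      by (auto simp: r_def intro!: mult_le_one power_le_one)
    \<comment> \<open>The norms are real powers of \<open>r z\<close>, which decrease as the
      exponent grows because \<open>r z\<close> is at most 1.\<close>
    have "norm (of_real (r z) powr (w + 2 * of_nat n) :: complex) \<le> norm (of_real (r z) powr w :: complex)"
      using r by (simp add: norm_powr_real_powr powr_mono')
    then have "norm (K n z) \<le> norm (K 0 z)"
      using True by (simp add: K_shift norm_mult mult_left_mono del: of_real_diff)
    then have "norm A * (norm (d n) * norm (K n z)) \<le> norm A * (norm (d n) * norm (K 0 z))"
      by (intro mult_left_mono) auto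
    then show ?thesis
      using True by (simp add: T_def norm_mult mult_ac)
  qed (auto simp: T_def indicator_def)
  have T_summable: "summable (\<lambda>n. norm (T n z))" for z
    by (rule summable_comparison_test'[OF summable_mult2[OF d_summable]]) (use T_bound in simp)
  have T_integral_summable: "summable (\<lambda>n. \<integral>z. norm (T n z) \<partial>lborel)"
  proof (rule summable_comparison_test')
    define M where "M = (\<integral>z. norm (A * (indicator {0<..<1} z *\<^sub>R K 0 z)) \<partial>lborel)"
    show "summable (\<lambda>n. norm (d n) * M)"
      by (rule summable_mult2[OF d_summable])
    show "norm (\<integral>z. norm (T n z) \<partial>lborel) \<le> norm (d n) * M" if "n \<ge> 0" for n
    proof -
      have int: "integrable lborel (\<lambda>z. norm (A * (indicator {0<..<1} z *\<^sub>R K 0 z)))"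
        using K_int[of 0] by (intro integrable_norm integrable_mult_right) (simp add: set_integrable_def)
      have "(\<integral>z. norm (T n z) \<partial>lborel) \<le> (\<integral>z. norm (d n) * norm (A * (indicator {0<..<1} z *\<^sub>R K 0 z)) \<partial>lborel)"
        by (rule integral_mono[OF integrable_norm[OF T_int] integrable_mult_right[OF int] T_bound])
      then show ?thesis by (simp add: M_def)
    qed
  qed
  note T = T_int AE_I2[OF T_summable] T_integral_summable
  \<comment> \<open>The series expansion needs \<open>r z > 0\<close>, which fails at
    \<open>z = 1\<close>. The two endpoints form a null set and are discarded in the integrals
    below.\<close>
  have sum_eq: "(\<Sum>n. T n z) = indicator {0..1} z *\<^sub>R f z" if "z \<notin> {0, 1}" for z
  proof (cases "0 < z \<and> z < 1")
    case True
    then have r: "r z > 0" by (simp add: r_def)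
    define G where "G = complex_of_real z powr (l + \<rho> - 1) * complex_of_real (1 - z) powr (2 * l - 1)
      * complex_of_real (1 - z / 3) powr (2 * (l + \<rho>) - 1) * complex_of_real (1 - z / 4) powr (l - 1)"
    define B where "B = (\<lambda>n. A * (d n * of_real (r z) powr (w + 2 * of_nat n)))"
    have B: "k_bessel k v (y * of_real (r z)) = (\<Sum>n. B n)"
      unfolding k_bessel_def B_def A_def d_def x_def w_def
      by (subst k_bessel_term[OF assms(1,2) r]) (rule refl)
    have T_eq: "T n z = G * B n" for n
      using True K_shift[of z n] by (simp add: T_def B_def G_def mult_ac)
    have "(\<Sum>n. T n z) = G * (\<Sum>n. B n)"
    \<comment> \<open>Summability is known for \<open>G * B n\<close> and passes to
      \<open>B n\<close> only by cancelling \<open>G\<close>; for \<open>G = 0\<close> both sides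
      vanish.\<close>
    proof (cases "G = 0")
      case False
      have "summable (\<lambda>n. G * B n)"
        using summable_norm_cancel[OF T_summable[of z]] by (simp only: T_eq)
      with False show ?thesis
        unfolding T_eq by (intro suminf_mult) (simp add: summable_cmult_iff)
    qed (simp add: T_eq)
    then show ?thesis
      using True by (simp add: f_def G_def B)
  next
    case False
    with that show ?thesis by (auto simp: T_def indicator_def)
  qed
  have "integrable lborel (\<lambda>z. indicator {0..1} z *\<^sub>R f z)"
    using integrable_suminf[OF T]
    by (subst (asm) integrable_discrete_difference[where X = "{0, 1}", OF _ _ _ sum_eq]) auto
  moreover have "(\<integral>z. indicator {0..1} z *\<^sub>R f z \<partial>lborel) =
      A * Gamma a * (2 / 3) powr (2 * a) * wright_1Psi2 (l + w) 2 (w + 1) 1 (2 * l + w + \<rho>) 2 x"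
  proof -
    define W where "W = (\<lambda>n. Gamma (l + w + of_real 2 * of_nat n)
            / (Gamma (w + 1 + of_real 1 * of_nat n) * Gamma (2 * l + w + \<rho> + of_real 2 * of_nat n))
            * (x ^ n / fact n))"
    define c where "c = A * Gamma a * (2 / 3) powr (2 * a)"
    have eq: "integral\<^sup>L lborel (T n) = c * W n" for n
    proof -
      \<comment> \<open>This sum is the argument of the denominator Gamma in
        \<open>Beta a (b n)\<close>, hence the second lower parameter of the Wright
        function.\<close>
      have "a + b n = 2 * l + w + \<rho> + of_real 2 * of_nat n"
        by (simp add: a_def b_def)
      moreover have "b n = l + w + of_real 2 * of_nat n"
        by (simp add: b_def)
      moreover have "w + of_nat n + 1 = w + 1 + of_real 1 * of_nat n"
        by simp
      ultimately have "Beta a (b n) = Gamma a * Gamma (l + w + of_real 2 * of_nat n)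
          / Gamma (2 * l + w + \<rho> + of_real 2 * of_nat n)"
        and "d n = x ^ n / (Gamma (w + 1 + of_real 1 * of_nat n) * fact n)"
        by (simp_all only: Beta_def d_def)
      then show ?thesis
        by (simp only: T_integral W_def c_def) (simp add: mult_ac)
    qed
    have c: "(\<Sum>n. c * W n) = c * (\<Sum>n. W n)"
    \<comment> \<open>The constant does vanish when \<open>y = 0\<close> and \<open>w\<close> is
      nonzero. The integrals then say nothing about summability of \<open>W\<close>, but both sides
      are 0.\<close>
    proof (cases "c = 0")
      case False
      then show ?thesis
        using summable_integral[OF T] by (intro suminf_mult) (simp add: eq summable_cmult_iff)
    qed simp
    have "(\<integral>z. indicator {0..1} z *\<^sub>R f z \<partial>lborel) = (\<integral>z. (\<Sum>n. T n z) \<partial>lborel)"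
      by (rule integral_discrete_difference[where X = "{0, 1}", OF _ _ _ sum_eq [symmetric]]) auto
    also have "\<dots> = c * (\<Sum>n. W n)"
      unfolding integral_suminf[OF T] eq c ..
    finally show ?thesis
      by (simp add: c_def W_def wright_1Psi2_def)
  qed
  ultimately show ?thesis
    unfolding Let_def set_integrable_def set_lebesgue_integral_def
    by (simp add: f_def r_def A_def a_def w_def x_def)
qed

end
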